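(* Let $a,b\in\mathbb N=\{0,1,2,\dots\}$. For the polynomials $p,\widetilde p,q,\widetilde q$ (defined in the context) which form the basis of the space $\mathcal M_{a,b}^1(2)$ of spherical Hermitian monogenics in complex dimension $2$, the derivatives with respect to $z_2$ and $\overline z_2$ satisfy: (i) if $a<b$: - $\partial_{z_2}p_{a,b;c,0}=p_{a-1,b;c,0}$ for $c=0,\dots,a-1$; - $\partial_{z_2}p_{a,b;a,0}=0$; - $\partial_{z_2}\widetilde q_{a,b;0,d}=\widetilde q_{a-1,b;0,d}$ for $d=0,\dots,b-a-1$; - $\partial_{z_2}q_{a,b;0,b-a}=\widetilde q_{a-1,b;0,b-a}$; - $\partial_{z_2}q_{a,b;0,d}=q_{a-1,b;0,d}$ for $d=b-a+1,\dots,b$; - $\partial_{\overline z_2}p_{a,b;c,0}=p_{a,b-1;c,0}$ for $c=0,\dots,a$; - $\partial_{\overline z_2}\widetilde q_{a,b;0,d}=\widetilde q_{a,b-1;0,d}$ for $d=0,\dots,b-a-2$; - $\partial_{\overline z_2}\widetilde q_{a,b;0,b-a-1}=q_{a,b-1;0,b-a-1}$; - $\partial_{\overline z_2}q_{a,b;0,d}=q_{a,b-1;0,d}$ for $d=b-a,\dots,b-1$; - $\partial_{\overline z_2}q_{a,b;0,b}=0$. (ii) if $a>b$: - $\partial_{z_2}\widetilde p_{a,b;c,0}=\widetilde p_{a-1,b;c,0}$ for $c=0,\dots,a-b-2$; - $\partial_{z_2}\widetilde p_{a,b;a-b-1,0}=p_{a-1,b;a-b-1,0}$; - $\partial_{z_2}p_{a,b;c,0}=p_{a-1,b;c,0}$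 for $c=a-b,\dots,a-1$; - $\partial_{z_2}p_{a,b;a,0}=0$; - $\partial_{z_2}q_{a,b;0,d}=q_{a-1,b;0,d}$ for $d=0,\dots,b$; - $\partial_{\overline z_2}\widetilde p_{a,b;c,0}=\widetilde p_{a,b-1;c,0}$ for $c=0,\dots,a-b-1$; - $\partial_{\overline z_2}p_{a,b;a-b,0}=\widetilde p_{a,b-1;a-b,0}$; - $\partial_{\overline z_2}p_{a,b;c,0}=p_{a,b-1;c,0}$ for $c=a-b+1,\dots,a$; - $\partial_{\overline z_2}q_{a,b;0,d}=q_{a,b-1;0,d}$ for $d=0,\dots,b-1$; - $\partial_{\overline z_2}q_{a,b;0,b}=0$. (iii) if $a=b$: - $\partial_{z_2}p_{a,a;c,0}=p_{a-1,a;c,0}$ for $c=0,\dots,a-1$; - $\partial_{z_2}p_{a,a;a,0}=0$; - $\partial_{z_2}q_{a,a;0,0}=\widetilde q_{a-1,a;0,0}$; - $\partial_{z_2}q_{a,a;0,d}=q_{a-1,a;0,d}$ for $d=1,\dots,a$; - $\partial_{\overline z_2}p_{a,a;0,0}=\widetilde p_{a,a-1;0,0}$; - $\partial_{\overline z_2}p_{a,a;c,0}=p_{a,a-1;c,0}$ for $c=1,\dots,a$; - $\partial_{\overline z_2}q_{a,a;0,d}=q_{a,a-1;0,d}$ for $d=0,\dots,a-1$; - $\partial_{\overline z_2}q_{a,a;0,a}=0$. The derivatives with respect to $z_1$ and $\overline z_1$ satisfy: (i) if $a<b$: - $\partial_{z_1}p_{a,b;0,0}=-\widetilde q_{a-1,b;0,0}$;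 - $\partial_{z_1}p_{a,b;c,0}=p_{a-1,b;c-1,0}$ for $c=1,\dots,a$; - $\partial_{z_1}\widetilde q_{a,b;0,d}=-\widetilde q_{a-1,b;0,d+1}$ for $d=0,\dots,b-a-1$; - $\partial_{z_1}q_{a,b;0,d}=-q_{a-1,b;0,d+1}$ for $d=b-a,\dots,b-1$; - $\partial_{z_1}q_{a,b;0,b}=0$; - $\partial_{\overline z_1}p_{a,b;c,0}=-p_{a,b-1;c+1,0}$ for $c=0,\dots,a-1$; - $\partial_{\overline z_1}p_{a,b;a,0}=0$; - $\partial_{\overline z_1}\widetilde q_{a,b;0,0}=p_{a,b-1;0,0}$; - $\partial_{\overline z_1}\widetilde q_{a,b;0,d}=\widetilde q_{a,b-1;0,d-1}$ for $d=1,\dots,b-a-1$; - $\partial_{\overline z_1}q_{a,b;0,d}=q_{a,b-1;0,d-1}$ for $d=b-a,\dots,b$. (ii) if $a>b$: - $\partial_{z_1}\widetilde p_{a,b;0,0}=-q_{a-1,b;0,0}$; - $\partial_{z_1}\widetilde p_{a,b;c,0}=\widetilde p_{a-1,b;c-1,0}$ for $c=1,\dots,a-b-1$; - $\partial_{z_1}p_{a,b;c,0}=p_{a-1,b;c-1,0}$ for $c=a-b,\dots,a$; - $\partial_{z_1}q_{a,b;0,d}=-q_{a-1,b;0,d+1}$ for $d=0,\dots,b-1$; - $\partial_{z_1}q_{a,b;0,b}=0$; - $\partial_{\overline z_1}\widetilde p_{a,b;c,0}=-\widetilde p_{a,b-1;c+1,0}$ for $c=0,\dots,a-b-1$; - $\partial_{\overline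 z_1}p_{a,b;c,0}=-p_{a,b-1;c+1,0}$ for $c=a-b,\dots,a-1$; - $\partial_{\overline z_1}p_{a,b;a,0}=0$; - $\partial_{\overline z_1}q_{a,b;0,0}=\widetilde p_{a,b-1;0,0}$; - $\partial_{\overline z_1}q_{a,b;0,d}=q_{a,b-1;0,d-1}$ for $d=1,\dots,b$. (iii) if $a=b$: - $\partial_{z_1}p_{a,a;0,0}=-\widetilde q_{a-1,a;0,0}$; - $\partial_{z_1}p_{a,a;c,0}=p_{a-1,a;c-1,0}$ for $c=1,\dots,a$; - $\partial_{z_1}q_{a,a;0,d}=-q_{a-1,a;0,d+1}$ for $d=0,\dots,a-1$; - $\partial_{z_1}q_{a,a;0,a}=0$; - $\partial_{\overline z_1}p_{a,a;c,0}=-p_{a,a-1;c+1,0}$ for $c=0,\dots,a-1$; - $\partial_{\overline z_1}p_{a,a;a,0}=0$; - $\partial_{\overline z_1}q_{a,a;0,0}=\widetilde p_{a,a-1;0,0}$; - $\partial_{\overline z_1}q_{a,a;0,d}=q_{a,a-1;0,d-1}$ for $d=1,\dots,a$.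
   Context: **Clifford algebra and spinors ($n=2$).** $\mathbb C_4$ is the complex Clifford algebra generated by $e_1,\dots,e_4$ with $e_\alpha e_\beta+e_\beta e_\alpha=-2\delta_{\alpha\beta}$. The Witt basis is $\mathfrak f_j=\frac12(e_j-i\,e_{2+j})$, $\mathfrak f_j^\dagger=-\frac12(e_j+i\,e_{2+j})$, $j=1,2$; $I=\mathfrak f_1\mathfrak f_1^\dagger\mathfrak f_2\mathfrak f_2^\dagger$; $\mathbb S_2^{(1)}=\mathrm{span}_{\mathbb C}\{\mathfrak f_1^\dagger I,\mathfrak f_2^\dagger I\}$ (a two-dimensional space). With complex variables $z_1,z_2$ on $\mathbb C^2$, $\mathcal M_{a,b}^1(2)$ is the space of $\mathbb S_2^{(1)}$-valued polynomials $g$, homogeneous of degree $a$ in $(z_1,z_2)$ and of degree $b$ in $(\overline z_1,\overline z_2)$, with $(\mathfrak f_1^\dagger\partial_{z_1}+\mathfrak f_2^\dagger\partial_{z_2})g=0=(\mathfrak f_1\partial_{\overline z_1}+\mathfrak f_2\partial_{\overline z_2})g$. Here $\partial_{z_j},\partial_{\overline z_j}$ are the usual Wirtinger derivatives. **Modified Jacobi polynomials.** For $l\in\mathbb N$, $$Q_l^{\alpha,\beta}=\sum_{s=0}^l\binom{l+\alpha}{s}\binom{l+\beta}{l-s}(-z_1\overline z_1)^{l-s}(z_2\overline z_2)^s,\qquad Q_{-1}^{\alpha,\beta}=0.$$ **Basis polynomials.** For $a,b\in\mathbb N$ define $$p_{a,b;c,0}=\frac1{a!\,b!}\Big(z_1^c\,\overline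 z_2^{\,b-a+c}Q_{a-c}^{c,b-a+c}\,\mathfrak f_1^\dagger I+z_1^{c+1}\overline z_2^{\,b-a+c+1}Q_{a-c-1}^{c+1,b-a+c+1}\,\mathfrak f_2^\dagger I\Big),\quad \max(0,a-b)\le c\le a,$$ $$q_{a,b;0,d}=\frac1{a!\,b!}\Big(\overline z_1^{\,d+1}z_2^{a-b+d+1}Q_{b-d-1}^{d+1,a-b+d+1}\,\mathfrak f_1^\dagger I-\overline z_1^{\,d}z_2^{a-b+d}Q_{b-d}^{d,a-b+d}\,\mathfrak f_2^\dagger I\Big),\quad \max(0,b-a)\le d\le b,$$ and, if $a<b$, $$\widetilde q_{a,b;0,d}=\frac1{(a+d+1)!\,(b-d)!}\Big((b-d)\,\overline z_1^{\,d+1}\overline z_2^{\,b-d-a-1}Q_a^{d+1,b-d-a-1}\,\mathfrak f_1^\dagger I-(a+d+1)\,\overline z_1^{\,d}\,\overline z_2^{\,b-d-a}Q_a^{d,b-d-a}\,\mathfrak f_2^\dagger I\Big),\quad 0\le d\le b-a-1,$$ and, if $a>b$, $$\widetilde p_{a,b;c,0}=\frac1{(a-c)!\,(b+c+1)!}\Big((b+c+1)\,z_1^cz_2^{a-c-b}Q_b^{c,a-c-b}\,\mathfrak f_1^\dagger I+(a-c)\,z_1^{c+1}z_2^{a-c-b-1}Q_b^{c+1,a-c-b-1}\,\mathfrak f_2^\dagger I\Big),\quad 0\le c\le a-b-1.$$ Any of these symbols whose first or second index is $-1$ denotes the zero polynomial. *)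

theory Defs
  imports "HOL-Analysis.Analysis"
begin

text \<open>
  The complex Clifford algebra with one generator \<open>e\<^sub>a\<close> for each \<open>a :: 'n\<close> is realised on the vector
  space with basis \<open>e\<^sub>A\<close> (\<open>A :: 'n set\<close>), where \<open>e\<^sub>A\<close> is the product of the generators \<open>e\<^sub>a\<close>,
  \<open>a \<in> A\<close>, in increasing order.  Then \<open>e\<^sub>A e\<^sub>B = \<plusminus> e\<^bsub>sym_diff A B\<^esub>\<close>: moving \<open>e\<^sub>b\<close> to the left past
  every \<open>e\<^sub>a\<close> with \<open>a > b\<close> and using \<open>e\<^sub>a\<^sup>2 = -1\<close> gives a factor \<open>-1\<close> for each pair
  \<open>(a, b) \<in> A \<times> B\<close> with \<open>b \<le> a\<close>.

  The library's \<open>*\<close> on this type is the componentwise product and is not used; \<open>c *s x\<close> is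
  multiplication by a complex scalar.
\<close>

type_synonym 'n clifford = "complex ^ ('n set)"

definition blade :: "'n::finite set \<Rightarrow> 'n clifford" where
  "blade A = axis A 1"

definition blade_sign :: "'n::{finite,linorder} set \<Rightarrow> 'n set \<Rightarrow> complex" where
  "blade_sign A B = (\<Prod>a\<in>A. \<Prod>b\<in>B. if b \<le> a then -1 else 1)"

definition clifford_mult ::
    "'n::{finite,linorder} clifford \<Rightarrow> 'n clifford \<Rightarrow> 'n clifford"  (infixl "\<odot>" 75) where
  "x \<odot> y = (\<Sum>A\<in>UNIV. \<Sum>B\<in>UNIV. (blade_sign A B * x $ A * y $ B) *s blade (sym_diff A B))"

definition gen :: "'n::finite \<Rightarrow> 'n clifford" where
  "gen a = blade {a}"

lemma clifford_mult_add_left: "(x + y) \<odot> z = x \<odot> z + y \<odot> z"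
  by (simp add: clifford_mult_def vec_eq_iff sum.distrib algebra_simps)

lemma clifford_mult_add_right: "x \<odot> (y + z) = x \<odot> y + x \<odot> z"
  by (simp add: clifford_mult_def vec_eq_iff sum.distrib algebra_simps)

lemma clifford_mult_scale_left: "(c *s x) \<odot> y = c *s (x \<odot> y)"
  by (simp add: clifford_mult_def vec_eq_iff sum_distrib_left algebra_simps)

lemma clifford_mult_scale_right: "x \<odot> (c *s y) = c *s (x \<odot> y)"
  by (simp add: clifford_mult_def vec_eq_iff sum_distrib_left algebra_simps)

lemma clifford_mult_sum_left: "sum f S \<odot> y = (\<Sum>i\<in>S. f i \<odot> y)"
proof (induction S rule: infinite_finite_induct)
  case (insert i S)
  then show ?case by (simp add: clifford_mult_add_left)
qed (simp_all add: clifford_mult_def vec_eq_iff)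

lemma clifford_mult_sum_right: "x \<odot> sum f S = (\<Sum>i\<in>S. x \<odot> f i)"
proof (induction S rule: infinite_finite_induct)
  case (insert i S)
  then show ?case by (simp add: clifford_mult_add_right)
qed (simp_all add: clifford_mult_def vec_eq_iff)

lemma clifford_expand: "(x :: 'n::finite clifford) = (\<Sum>A\<in>UNIV. x $ A *s blade A)"
  by (simp add: vec_eq_iff blade_def axis_def if_distrib[of "\<lambda>u. _ * u"] cong: if_cong)

lemma blade_mult: "blade A \<odot> blade B = blade_sign A B *s blade (sym_diff A B)"
proof -
  have "(blade_sign A' B' * blade A $ A' * blade B $ B') *s blade (sym_diff A' B') =
      (if A' = A then if B' = B then blade_sign A B *s blade (sym_diff A B) else 0 else 0)"
    for A' B' :: "'a set"
    by (auto simp: blade_def axis_def vec_eq_iff)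
  then show ?thesis
    unfolding clifford_mult_def
    by (subst sum.cong[OF refl, of _ _ "\<lambda>A'. if A' = A then blade_sign A B *s blade (sym_diff A B) else 0"])
       auto
qed

lemma prod_sym_diff:
  fixes f :: "'a::finite \<Rightarrow> 'b::comm_monoid_mult"
  assumes "\<And>a. f a * f a = 1"
  shows "prod f (sym_diff A B) = prod f A * prod f B"
proof -
  have 1: "prod f (sym_diff A B) = prod f (A - B) * prod f (B - A)"
    by (rule prod.union_disjoint) auto
  have 2: "prod f A = prod f (A - B) * prod f (A \<inter> B)"
    by (metis Diff_Diff_Int Diff_subset finite mult.commute prod.subset_diff)
  have 3: "prod f B = prod f (B - A) * prod f (A \<inter> B)"
    by (metis Diff_Diff_Int Diff_subset Int_commute finite mult.commute prod.subset_diff)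
  have 4: "prod f (A \<inter> B) * prod f (A \<inter> B) = 1"
    using assms by (simp flip: prod.distrib)
  have "prod f A * prod f B =
      prod f (A - B) * prod f (B - A) * (prod f (A \<inter> B) * prod f (A \<inter> B))"
    unfolding 2 3 by (simp only: ac_simps)
  then show ?thesis
    unfolding 1 4 by simp
qed

lemma blade_sign_sym_diff_left: "blade_sign (sym_diff A B) C = blade_sign A C * blade_sign B C"
  unfolding blade_sign_def by (rule prod_sym_diff) (auto simp flip: prod.distrib intro!: prod.neutral)

lemma blade_sign_sym_diff_right: "blade_sign A (sym_diff B C) = blade_sign A B * blade_sign A C"
  unfolding blade_sign_def by (subst prod_sym_diff) (simp_all add: prod.distrib)

lemma blade_mult_assoc: "(blade A \<odot> blade B) \<odot> blade C = blade A \<odot> (blade B \<odot> blade C)"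
proof -
  have "sym_diff (sym_diff A B) C = sym_diff A (sym_diff B C)" by auto
  then show ?thesis
    by (simp only: blade_mult clifford_mult_scale_left clifford_mult_scale_right
        blade_sign_sym_diff_left blade_sign_sym_diff_right vector_smult_assoc ac_simps)
qed

theorem clifford_mult_assoc: "(x \<odot> y) \<odot> z = x \<odot> (y \<odot> z)"
proof -
  have "(x \<odot> y) \<odot> z = ((\<Sum>A\<in>UNIV. x $ A *s blade A) \<odot> (\<Sum>A\<in>UNIV. y $ A *s blade A))
      \<odot> (\<Sum>A\<in>UNIV. z $ A *s blade A)"
    by (simp flip: clifford_expand)
  also have "\<dots> = (\<Sum>A\<in>UNIV. x $ A *s blade A) \<odot> ((\<Sum>A\<in>UNIV. y $ A *s blade A)
      \<odot> (\<Sum>A\<in>UNIV. z $ A *s blade A))"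
    by (simp only: clifford_mult_sum_left clifford_mult_sum_right clifford_mult_scale_left
        clifford_mult_scale_right blade_mult_assoc)
  finally show ?thesis by (simp flip: clifford_expand)
qed

theorem clifford_mult_1_left: "blade {} \<odot> x = x"
proof -
  have "blade {} \<odot> (\<Sum>A\<in>UNIV. x $ A *s blade A) = (\<Sum>A\<in>UNIV. x $ A *s blade A)"
    by (simp add: clifford_mult_sum_right clifford_mult_scale_right blade_mult blade_sign_def)
  then show ?thesis by (simp flip: clifford_expand)
qed

theorem clifford_mult_1_right: "x \<odot> blade {} = x"
proof -
  have "(\<Sum>A\<in>UNIV. x $ A *s blade A) \<odot> blade {} = (\<Sum>A\<in>UNIV. x $ A *s blade A)"
    by (simp add: clifford_mult_sum_left clifford_mult_scale_left blade_mult blade_sign_def)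
  then show ?thesis by (simp flip: clifford_expand)
qed

theorem gen_anticommute:
  "gen a \<odot> gen b + gen b \<odot> gen a = (if a = b then -2 else 0) *s blade {}"
proof (cases "a = b")
  case True
  then show ?thesis by (simp add: gen_def blade_mult blade_sign_def vec_eq_iff)
next
  case False
  then have "sym_diff {a} {b} = {a, b}" "sym_diff {b} {a} = {a, b}" by auto
  with False show ?thesis
    by (auto simp: gen_def blade_mult blade_sign_def vec_eq_iff)
qed

theorem blade_insert:
  assumes "\<And>b. b \<in> B \<Longrightarrow> a < b"
  shows "blade (insert a B) = gen a \<odot> blade B"
proof -
  have "a \<notin> B" using assms by blast
  then have "sym_diff {a} B = insert a B" by auto
  moreover have "blade_sign {a} B = 1"
    using assms by (fastforce simp: blade_sign_def intro!: prod.neutral)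
  ultimately show ?thesis by (simp add: gen_def blade_mult)
qed

text \<open>
  In the type \<open>4\<close> the numeral \<open>4\<close> denotes the element \<open>0\<close>, so that the four generators are
  \<open>gen 1\<close>, \<open>gen 2\<close>, \<open>gen 3\<close> and \<open>gen 4\<close>, with \<open>gen 4\<close> first in the (immaterial) order.
\<close>

definition witt :: "4 \<Rightarrow> 4 clifford" where
  "witt j = (1/2) *s (gen j - \<i> *s gen (2 + j))"

definition witt_dag :: "4 \<Rightarrow> 4 clifford" where
  "witt_dag j = - ((1/2) *s (gen j + \<i> *s gen (2 + j)))"

definition spinor_I :: "4 clifford" where
  "spinor_I = witt 1 \<odot> witt_dag 1 \<odot> witt 2 \<odot> witt_dag 2"

definition spinor1 :: "4 clifford" where
  "spinor1 = witt_dag 1 \<odot> spinor_I"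

definition spinor2 :: "4 clifford" where
  "spinor2 = witt_dag 2 \<odot> spinor_I"

text \<open>
  The Wirtinger derivatives \<open>\<partial>\<^sub>z = (\<partial>\<^sub>x - i \<partial>\<^sub>y) / 2\<close> and its conjugate in the \<open>j\<close>-th variable,
  where \<open>z\<^sub>j = x\<^sub>j + i y\<^sub>j\<close>.
\<close>

definition dx :: "'n::finite \<Rightarrow> (complex ^ 'n \<Rightarrow> complex ^ 'm) \<Rightarrow> complex ^ 'n \<Rightarrow> complex ^ 'm" where
  "dx j f z = vector_derivative (\<lambda>t. f (z + t *\<^sub>R axis j 1)) (at 0)"

definition dy :: "'n::finite \<Rightarrow> (complex ^ 'n \<Rightarrow> complex ^ 'm) \<Rightarrow> complex ^ 'n \<Rightarrow> complex ^ 'm" where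
  "dy j f z = vector_derivative (\<lambda>t. f (z + t *\<^sub>R axis j \<i>)) (at 0)"

definition dz :: "'n::finite \<Rightarrow> (complex ^ 'n \<Rightarrow> complex ^ 'm) \<Rightarrow> complex ^ 'n \<Rightarrow> complex ^ 'm" where
  "dz j f z = (1/2) *s (dx j f z - \<i> *s dy j f z)"

definition dzbar :: "'n::finite \<Rightarrow> (complex ^ 'n \<Rightarrow> complex ^ 'm) \<Rightarrow> complex ^ 'n \<Rightarrow> complex ^ 'm" where
  "dzbar j f z = (1/2) *s (dx j f z + \<i> *s dy j f z)"

text \<open>
  The indices below are integers, since \<open>-1\<close> occurs as an index.  In the index ranges for which the
  polynomials are considered, every argument of \<open>nat\<close> is nonnegative, except in terms in which
  \<open>jacobi_Q\<close> has first index \<open>-1\<close> and thus vanishes.  No meaning is attached to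
  the values outside these ranges.
\<close>

definition jacobi_Q :: "int \<Rightarrow> int \<Rightarrow> int \<Rightarrow> complex ^ 2 \<Rightarrow> complex" where
  "jacobi_Q l \<alpha> \<beta> z =
    (if l < 0 then 0
     else \<Sum>s = 0..nat l. of_nat (nat (l + \<alpha>) choose s) * of_nat (nat (l + \<beta>) choose (nat l - s))
            * (- z $ 1 * cnj (z $ 1)) ^ (nat l - s) * (z $ 2 * cnj (z $ 2)) ^ s)"

definition p_poly :: "int \<Rightarrow> int \<Rightarrow> int \<Rightarrow> complex ^ 2 \<Rightarrow> 4 clifford" where
  "p_poly a b c z =
    (if a < 0 \<or> b < 0 then 0
     else (1 / (fact (nat a) * fact (nat b))) *s
       ((z $ 1 ^ nat c * cnj (z $ 2) ^ nat (b - a + c) * jacobi_Q (a - c) c (b - a + c) z) *s spinor1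
        + (z $ 1 ^ nat (c + 1) * cnj (z $ 2) ^ nat (b - a + c + 1)
            * jacobi_Q (a - c - 1) (c + 1) (b - a + c + 1) z) *s spinor2))"

definition q_poly :: "int \<Rightarrow> int \<Rightarrow> int \<Rightarrow> complex ^ 2 \<Rightarrow> 4 clifford" where
  "q_poly a b d z =
    (if a < 0 \<or> b < 0 then 0
     else (1 / (fact (nat a) * fact (nat b))) *s
       ((cnj (z $ 1) ^ nat (d + 1) * z $ 2 ^ nat (a - b + d + 1)
            * jacobi_Q (b - d - 1) (d + 1) (a - b + d + 1) z) *s spinor1
        - (cnj (z $ 1) ^ nat d * z $ 2 ^ nat (a - b + d) * jacobi_Q (b - d) d (a - b + d) z) *s spinor2))"

text \<open>The polynomials with tildes, for \<open>a < b\<close> and for \<open>a > b\<close> respectively.\<close>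

definition qt_poly :: "int \<Rightarrow> int \<Rightarrow> int \<Rightarrow> complex ^ 2 \<Rightarrow> 4 clifford" where
  "qt_poly a b d z =
    (if a < 0 \<or> b < 0 then 0
     else (1 / (fact (nat (a + d + 1)) * fact (nat (b - d)))) *s
       ((of_int (b - d) * cnj (z $ 1) ^ nat (d + 1) * cnj (z $ 2) ^ nat (b - d - a - 1)
            * jacobi_Q a (d + 1) (b - d - a - 1) z) *s spinor1
        - (of_int (a + d + 1) * cnj (z $ 1) ^ nat d * cnj (z $ 2) ^ nat (b - d - a)
            * jacobi_Q a d (b - d - a) z) *s spinor2))"

definition pt_poly :: "int \<Rightarrow> int \<Rightarrow> int \<Rightarrow> complex ^ 2 \<Rightarrow> 4 clifford" where
  "pt_poly a b c z =
    (if a < 0 \<or> b < 0 then 0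
     else (1 / (fact (nat (a - c)) * fact (nat (b + c + 1)))) *s
       ((of_int (b + c + 1) * z $ 1 ^ nat c * z $ 2 ^ nat (a - c - b)
            * jacobi_Q b c (a - c - b) z) *s spinor1
        + (of_int (a - c) * z $ 1 ^ nat (c + 1) * z $ 2 ^ nat (a - c - b - 1)
            * jacobi_Q b (c + 1) (a - c - b - 1) z) *s spinor2))"

end

theory Submission
  imports Defs
begin

text \<open>
  All four families are pieces of a single one.  Write \<open>x\<^bsup>[n]\<^esup> = x\<^sup>n / n!\<close> (zero for \<open>n < 0\<close>), and let
  \<open>F(a,b,c)\<close> be the sum of
  \<open>(-1)\<^sup>m z\<^sub>1\<^bsup>[k]\<^esup> z\<^sub>1'\<^bsup>[m]\<^esup> z\<^sub>2\<^bsup>[s]\<^esup> z\<^sub>2'\<^bsup>[n]\<^esup>\<close> over \<open>k + s = a\<close>, \<open>m + n = b\<close>, \<open>k - m = c\<close>, where a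
  prime denotes the complex conjugate.  Equivalently, \<open>F(a,b,c)\<close> is the coefficient of \<open>t\<^sup>c\<close> in
  \<open>(z\<^sub>2 + t z\<^sub>1)\<^bsup>[a]\<^esup> (z\<^sub>2' - z\<^sub>1' / t)\<^bsup>[b]\<^esup>\<close>.  Since \<open>x\<^bsup>[n]\<^esup>\<close> has derivative \<open>x\<^bsup>[n-1]\<^esup>\<close>, every
  Wirtinger derivative of \<open>F\<close> is a shift of the indices:
  \<open>\<partial>\<^sub>z\<^sub>2\<close> lowers \<open>a\<close>, \<open>\<partial>\<^sub>z\<^sub>2'\<close> lowers \<open>b\<close>, \<open>\<partial>\<^sub>z\<^sub>1\<close> lowers \<open>a\<close> and \<open>c\<close>, and \<open>\<partial>\<^sub>z\<^sub>1'\<close> lowers \<open>b\<close>, raises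
  \<open>c\<close> and changes the sign (\<open>charge_poly_along_axis\<close>).

  When the binomial coefficients of a modified Jacobi polynomial are expanded into factorials, it
  becomes such a sum of divided powers (\<open>jacobi_Q_divpow\<close>).  With
  \<open>P(a,b,c) = F(a,b,c) f\<^sub>1 + F(a,b,c+1) f\<^sub>2\<close>, where \<open>f\<^sub>1, f\<^sub>2\<close> is the spinor basis, the polynomials \<open>p\<close> and
  \<open>p~\<close> with index \<open>c\<close> both equal \<open>P(a,b,c)\<close>, and \<open>q\<close> and \<open>q~\<close> with index \<open>d\<close> both equal
  \<open>(-1)\<^bsup>d+1\<^esup> P(a,b,-d-1)\<close>.  The four symbols only record which of the exponents in the monomial prefactor
  are taken by a variable or by its conjugate, that is, the sign of \<open>c\<close> and of \<open>b - a + c\<close>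
  (\<open>p_poly_eq_monogenic\<close> and its three companions).  The many cases of the proposition are
  therefore the four shift rules for \<open>P\<close>, read in the ranges in which each symbol is a name for \<open>P\<close>;
  the zero derivatives are the shifts that leave the range \<open>-b-1 \<le> c \<le> a\<close> outside which \<open>P\<close> vanishes
  (\<open>monogenic_eq_0\<close>).
\<close>

section \<open>Divided powers\<close>

text \<open>
  Integer exponents, with value zero below zero, let the derivative rule hold for every exponent,
  so that no boundary terms have to be separated later.
\<close>

definition divpow :: "complex \<Rightarrow> int \<Rightarrow> complex" where
  "divpow w n = (if n < 0 then 0 else w ^ nat n / fact (nat n))"

lemma divpow_of_neg [simp]: "n < 0 \<Longrightarrow> divpow w n = 0"
  by (simp add: divpow_def)

lemma divpow_has_field_derivative:
  "((\<lambda>w. divpow w n) has_field_derivative divpow w (n - 1)) (at w)"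
proof (cases "n \<le> 0")
  case True
  then have "(\<lambda>w. divpow w n) = (\<lambda>w. if n < 0 then 0 else 1)"
    by (auto simp: divpow_def)
  with True show ?thesis by simp
next
  case False
  then obtain m where n: "n = int (Suc m)"
    by (metis gr0_implies_Suc not_le zero_less_imp_eq_int of_nat_0_less_iff)
  have "((\<lambda>w. w ^ Suc m / fact (Suc m)) has_field_derivative
      of_nat (Suc m) * w ^ m / fact (Suc m)) (at w)"
    by (rule derivative_eq_intros refl)+ (simp_all del: fact_Suc power_Suc of_nat_Suc)
  moreover have "of_nat (Suc m) * w ^ m / fact (Suc m) = w ^ m / fact m"
    by (simp add: field_simps del: of_nat_Suc)
  ultimately show ?thesis
    by (simp add: n divpow_def nat_diff_distrib' del: fact_Suc power_Suc of_nat_Suc)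
qed

lemma divpow_along_line:
  "((\<lambda>t. divpow (w + t *\<^sub>R u) n) has_vector_derivative u * divpow w (n - 1)) (at 0)"
proof -
  have "((\<lambda>t. w + t *\<^sub>R u) has_vector_derivative u) (at 0)"
    by (auto intro!: derivative_eq_intros)
  moreover have "((\<lambda>w. divpow w n) has_field_derivative divpow w (n - 1)) (at (w + 0 *\<^sub>R u))"
    by (simp add: divpow_has_field_derivative)
  ultimately show ?thesis
    using field_vector_diff_chain_at unfolding o_def by fastforce
qed

section \<open>Wirtinger derivatives along real lines\<close>

text \<open>
  A single complex-linear plus conjugate-linear formula for the derivative in all real directions
  \<open>u\<close> of the \<open>j\<close>-th coordinate plane; the directions \<open>1\<close> and \<open>\<i>\<close> recover the two partial derivatives.
\<close>

definition has_wirtinger_derivatives ::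
    "'n::finite \<Rightarrow> (complex ^ 'n \<Rightarrow> complex ^ 'm::finite) \<Rightarrow>
      (complex ^ 'n \<Rightarrow> complex ^ 'm) \<Rightarrow> (complex ^ 'n \<Rightarrow> complex ^ 'm) \<Rightarrow> bool" where
  "has_wirtinger_derivatives j f D E \<longleftrightarrow>
    (\<forall>z u. ((\<lambda>t. f (z + t *\<^sub>R axis j u)) has_vector_derivative (u *s D z + cnj u *s E z)) (at 0))"

lemma
  assumes "has_wirtinger_derivatives j f D E"
  shows dz_eqI: "dz j f = D" and dzbar_eqI: "dzbar j f = E"
proof -
  have line: "((\<lambda>t. f (z + t *\<^sub>R axis j u)) has_vector_derivative (u *s D z + cnj u *s E z)) (at 0)"
    for z u using assms by (simp add: has_wirtinger_derivatives_def)
  have dx: "dx j f z = D z + E z" for z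
    using vector_derivative_at[OF line[of z 1]] by (simp add: dx_def)
  have dy: "dy j f z = \<i> *s (D z - E z)" for z
    using vector_derivative_at[OF line[of z \<i>]]
    by (simp add: dy_def vec_eq_iff algebra_simps)
  show "dz j f = D" "dzbar j f = E"
    by (auto simp: dz_def dzbar_def dx dy vec_eq_iff fun_eq_iff algebra_simps)
qed

section \<open>Polynomials of fixed bidegree and charge\<close>

definition monomial :: "int \<Rightarrow> int \<Rightarrow> int \<Rightarrow> int \<Rightarrow> complex ^ 2 \<Rightarrow> complex" where
  "monomial k m s n z =
    divpow (z $ 1) k * divpow (cnj (z $ 1)) m * divpow (z $ 2) s * divpow (cnj (z $ 2)) n"

lemma monomial_along_axis:
  "((\<lambda>t. monomial k m s n (z + t *\<^sub>R axis 1 u)) has_vector_derivative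
     (u * monomial (k - 1) m s n z + cnj u * monomial k (m - 1) s n z)) (at 0)"
  "((\<lambda>t. monomial k m s n (z + t *\<^sub>R axis 2 u)) has_vector_derivative
     (u * monomial k m (s - 1) n z + cnj u * monomial k m s (n - 1) z)) (at 0)"
proof -
  have axis: "(z + t *\<^sub>R axis 1 u) $ 1 = z $ 1 + t *\<^sub>R u" "(z + t *\<^sub>R axis 1 u) $ 2 = z $ 2"
    "(z + t *\<^sub>R axis 2 u) $ 1 = z $ 1" "(z + t *\<^sub>R axis 2 u) $ 2 = z $ 2 + t *\<^sub>R u"
    and cnj: "cnj (w + t *\<^sub>R u) = cnj w + t *\<^sub>R cnj u" for t w
    by (simp_all add: axis_def)
  have pair: "((\<lambda>t. divpow (w + t *\<^sub>R u) p * divpow (cnj w + t *\<^sub>R cnj u) q) has_vector_derivative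
      (u * (divpow w (p - 1) * divpow (cnj w) q) + cnj u * (divpow w p * divpow (cnj w) (q - 1)))) (at 0)"
    for w p q
    using has_vector_derivative_mult[OF divpow_along_line[of w u p] divpow_along_line[of "cnj w" "cnj u" q]]
    by (simp add: algebra_simps)
  show "((\<lambda>t. monomial k m s n (z + t *\<^sub>R axis 1 u)) has_vector_derivative
     (u * monomial (k - 1) m s n z + cnj u * monomial k (m - 1) s n z)) (at 0)"
    unfolding monomial_def axis cnj
    using has_vector_derivative_mult_left[OF pair[of "z $ 1" k m],
        of "divpow (z $ 2) s * divpow (cnj (z $ 2)) n"]
    by (simp add: algebra_simps)
  show "((\<lambda>t. monomial k m s n (z + t *\<^sub>R axis 2 u)) has_vector_derivative
     (u * monomial k m (s - 1) n z + cnj u * monomial k m s (n - 1) z)) (at 0)"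
    unfolding monomial_def axis cnj
    using has_vector_derivative_mult_right[OF pair[of "z $ 2" s n],
        of "divpow (z $ 1) k * divpow (cnj (z $ 1)) m"]
    by (simp add: algebra_simps)
qed

text \<open>
  The coefficient of \<open>t\<^sup>c\<close> in the generating function above.  The charge \<open>c\<close> is the weight under
  rotation of \<open>z\<^sub>1\<close>.  The sum runs over exactly those \<open>k\<close> for which all four exponents are nonnegative.
\<close>

definition charge_poly :: "int \<Rightarrow> int \<Rightarrow> int \<Rightarrow> complex ^ 2 \<Rightarrow> complex" where
  "charge_poly a b c z =
    (\<Sum>k\<in>{max 0 c..min a (b + c)}. (-1) powi (k - c) * monomial k (k - c) (a - k) (b + c - k) z)"

text \<open>
  Further indices only add zero terms; this allows several of these sums, with different bounds,
  to be compared over one index set.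
\<close>

lemma charge_poly_superset:
  assumes "finite K" and "{max 0 c..min a (b + c)} \<subseteq> K"
  shows "charge_poly a b c z =
    (\<Sum>k\<in>K. (-1) powi (k - c) * monomial k (k - c) (a - k) (b + c - k) z)"
  unfolding charge_poly_def
  using assms by (intro sum.mono_neutral_left) (auto simp: monomial_def divpow_def)

lemma charge_poly_eq_0: "a < 0 \<or> b < 0 \<or> c < - b \<or> a < c \<Longrightarrow> charge_poly a b c z = 0"
  by (auto simp: charge_poly_def intro!: sum.neutral)

text \<open>
  Termwise differentiation.  The sign in the first formula comes from the factor \<open>(-1)\<^sup>m\<close>, since the
  derivative in the conjugate of \<open>z\<^sub>1\<close> lowers \<open>m = k - c\<close>.
\<close>

lemma charge_poly_along_axis:
  "((\<lambda>t. charge_poly a b c (z + t *\<^sub>R axis 1 u)) has_vector_derivative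
     (u * charge_poly (a - 1) b (c - 1) z + cnj u * - charge_poly a (b - 1) (c + 1) z)) (at 0)"
  "((\<lambda>t. charge_poly a b c (z + t *\<^sub>R axis 2 u)) has_vector_derivative
     (u * charge_poly (a - 1) b c z + cnj u * charge_poly a (b - 1) c z)) (at 0)"
proof -
  \<comment> \<open>An interval that contains the index sets of all the sums involved, also after a shift by one.\<close>
  define K where "K = {-\<bar>a\<bar> - \<bar>b\<bar> - \<bar>c\<bar> - 2..\<bar>a\<bar> + \<bar>b\<bar> + \<bar>c\<bar> + 2}"
  let ?t = "\<lambda>a b c k z. (-1) powi (k - c) * monomial k (k - c) (a - k) (b + c - k) z"
  have F: "charge_poly a b c = (\<lambda>z. \<Sum>k\<in>K. ?t a b c k z)"
    by (intro ext charge_poly_superset) (auto simp: K_def)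
  have z2: "charge_poly (a - 1) b c z = (\<Sum>k\<in>K. ?t (a - 1) b c k z)"
    by (intro charge_poly_superset) (auto simp: K_def)
  have zbar2: "charge_poly a (b - 1) c z = (\<Sum>k\<in>K. ?t a (b - 1) c k z)"
    by (intro charge_poly_superset) (auto simp: K_def)
  have zbar1: "charge_poly a (b - 1) (c + 1) z = (\<Sum>k\<in>K. ?t a (b - 1) (c + 1) k z)"
    by (intro charge_poly_superset) (auto simp: K_def)
  \<comment> \<open>The derivative in \<open>z\<^sub>1\<close> lowers \<open>k\<close> itself, so this sum has to be reindexed.\<close>
  have "charge_poly (a - 1) b (c - 1) z = (\<Sum>k\<in>(\<lambda>k. k - 1) ` K. ?t (a - 1) b (c - 1) k z)"
    by (intro charge_poly_superset) (auto simp: K_def image_iff Bex_def intro!: exI[of _ "_ + 1"])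
  then have z1: "charge_poly (a - 1) b (c - 1) z = (\<Sum>k\<in>K. ?t (a - 1) b (c - 1) (k - 1) z)"
    by (simp add: sum.reindex inj_on_def)
  have sign: "(-1::complex) powi (k - (c + 1)) = - ((-1) powi (k - c))" for k
    using power_int_add[of "-1::complex" "k - (c + 1)" 1] by simp
  have "((\<lambda>t. charge_poly a b c (z + t *\<^sub>R axis 1 u)) has_vector_derivative
     (\<Sum>k\<in>K. (-1) powi (k - c) * (u * monomial (k - 1) (k - c) (a - k) (b + c - k) z
       + cnj u * monomial k (k - c - 1) (a - k) (b + c - k) z))) (at 0)"
    unfolding F
    by (intro has_vector_derivative_sum has_vector_derivative_mult_right monomial_along_axis)
  moreover have "(\<Sum>k\<in>K. (-1) powi (k - c) * (u * monomial (k - 1) (k - c) (a - k) (b + c - k) z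
       + cnj u * monomial k (k - c - 1) (a - k) (b + c - k) z)) =
     u * charge_poly (a - 1) b (c - 1) z + cnj u * - charge_poly a (b - 1) (c + 1) z"
    unfolding z1 zbar1 sign
    by (simp add: sum_distrib_left sum.distrib sum_negf algebra_simps)
  ultimately show "((\<lambda>t. charge_poly a b c (z + t *\<^sub>R axis 1 u)) has_vector_derivative
     (u * charge_poly (a - 1) b (c - 1) z + cnj u * - charge_poly a (b - 1) (c + 1) z)) (at 0)"
    by simp
  have "((\<lambda>t. charge_poly a b c (z + t *\<^sub>R axis 2 u)) has_vector_derivative
     (\<Sum>k\<in>K. (-1) powi (k - c) * (u * monomial k (k - c) (a - k - 1) (b + c - k) z
       + cnj u * monomial k (k - c) (a - k) (b + c - k - 1) z))) (at 0)"
    unfolding F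
    by (intro has_vector_derivative_sum has_vector_derivative_mult_right monomial_along_axis)
  moreover have "(\<Sum>k\<in>K. (-1) powi (k - c) * (u * monomial k (k - c) (a - k - 1) (b + c - k) z
       + cnj u * monomial k (k - c) (a - k) (b + c - k - 1) z)) =
     u * charge_poly (a - 1) b c z + cnj u * charge_poly a (b - 1) c z"
    unfolding z2 zbar2
    by (simp add: sum_distrib_left sum.distrib algebra_simps)
  ultimately show "((\<lambda>t. charge_poly a b c (z + t *\<^sub>R axis 2 u)) has_vector_derivative
     (u * charge_poly (a - 1) b c z + cnj u * charge_poly a (b - 1) c z)) (at 0)"
    by simp
qed

section \<open>The spinor-valued family and its derivatives\<close>

text \<open>
  The scalar \<open>\<epsilon>\<close> is carried along because the \<open>q\<close> families are signed members of the family and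
  some derivatives change the sign.
\<close>

definition monogenic :: "complex \<Rightarrow> int \<Rightarrow> int \<Rightarrow> int \<Rightarrow> complex ^ 2 \<Rightarrow> 4 clifford" where
  "monogenic \<epsilon> a b c z =
    \<epsilon> *s (charge_poly a b c z *s spinor1 + charge_poly a b (c + 1) z *s spinor2)"

lemma monogenic_eq_0:
  "a < 0 \<or> b < 0 \<or> c < - b - 1 \<or> a < c \<Longrightarrow> monogenic \<epsilon> a b c = (\<lambda>z. 0)"
  by (auto simp: monogenic_def fun_eq_iff charge_poly_eq_0)

lemma uminus_monogenic: "- monogenic \<epsilon> a b c = monogenic (- \<epsilon>) a b c"
  by (simp add: monogenic_def fun_eq_iff vec_eq_iff)

lemma has_vector_derivative_smult_const:
  fixes v :: "complex ^ 'n::finite"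
  assumes "(f has_vector_derivative f') F"
  shows "((\<lambda>t. f t *s v) has_vector_derivative f' *s v) F"
proof -
  have "linear (\<lambda>w. w *s v)"
    by (rule linearI) (simp_all add: vec_eq_iff algebra_simps)
  then show ?thesis
    using assms bounded_linear.has_vector_derivative linear_conv_bounded_linear by blast
qed

lemma monogenic_wirtinger:
  "has_wirtinger_derivatives 1 (monogenic \<epsilon> a b c)
     (monogenic \<epsilon> (a - 1) b (c - 1)) (monogenic (- \<epsilon>) a (b - 1) (c + 1))"
  "has_wirtinger_derivatives 2 (monogenic \<epsilon> a b c)
     (monogenic \<epsilon> (a - 1) b c) (monogenic \<epsilon> a (b - 1) c)"
proof -
  have expand: "monogenic \<epsilon> a b c =
      (\<lambda>z. charge_poly a b c z *s (\<epsilon> *s spinor1) + charge_poly a b (c + 1) z *s (\<epsilon> *s spinor2))"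
    by (auto simp: monogenic_def fun_eq_iff vec_eq_iff algebra_simps)
  show "has_wirtinger_derivatives 1 (monogenic \<epsilon> a b c)
     (monogenic \<epsilon> (a - 1) b (c - 1)) (monogenic (- \<epsilon>) a (b - 1) (c + 1))"
    unfolding has_wirtinger_derivatives_def
    by (auto simp: expand monogenic_def vec_eq_iff algebra_simps
        intro!: derivative_eq_intros has_vector_derivative_smult_const charge_poly_along_axis)
  show "has_wirtinger_derivatives 2 (monogenic \<epsilon> a b c)
     (monogenic \<epsilon> (a - 1) b c) (monogenic \<epsilon> a (b - 1) c)"
    unfolding has_wirtinger_derivatives_def
    by (auto simp: expand monogenic_def vec_eq_iff algebra_simps
        intro!: derivative_eq_intros has_vector_derivative_smult_const charge_poly_along_axis)
qed

lemmas monogenic_derivs =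
  monogenic_wirtinger[THEN dz_eqI] monogenic_wirtinger[THEN dzbar_eqI]

section \<open>Jacobi polynomials as sums of divided powers\<close>

text \<open>
  The upper entries \<open>l + \<alpha>\<close> and \<open>l + \<beta>\<close> of the binomial coefficients do not depend on the summation
  index, so they supply the common factor; the four lower factorials are just those of the four
  exponents once the prefactor \<open>u\<^sup>\<alpha> v\<^sup>\<beta>\<close> is multiplied in.  Each of \<open>{u, u'}\<close> and \<open>{v, v'}\<close> consists
  of a coordinate and its conjugate, and either one can take the prefactor: this gives the four
  families.
\<close>

lemma jacobi_Q_divpow:
  assumes "0 \<le> \<alpha>" "0 \<le> \<beta>" and u: "u * u' = z $ 1 * cnj (z $ 1)" and v: "v * v' = z $ 2 * cnj (z $ 2)"
  shows "u ^ nat \<alpha> * v ^ nat \<beta> * jacobi_Q l \<alpha> \<beta> z =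
    fact (nat (l + \<alpha>)) * fact (nat (l + \<beta>)) *
    (\<Sum>i\<in>{0..l}. (-1) powi i * (divpow u (\<alpha> + i) * divpow u' i * divpow v (l + \<beta> - i) * divpow v' (l - i)))"
proof (cases "l < 0")
  case True
  then show ?thesis by (simp add: jacobi_Q_def)
next
  case False
  then obtain L A B where eq: "l = int L" "\<alpha> = int A" "\<beta> = int B"
    using assms by (metis nonneg_int_cases not_less)
  \<comment> \<open>The index \<open>i = l - s\<close> is the smaller of the exponents of \<open>u\<close> and \<open>u'\<close>.\<close>
  let ?f = "\<lambda>i. (-1) powi i * (divpow u (\<alpha> + i) * divpow u' i * divpow v (l + \<beta> - i) * divpow v' (l - i))"
  have summand: "u ^ A * v ^ B * (of_nat ((L + A) choose (L - i)) * of_nat ((L + B) choose i)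
        * (- z $ 1 * cnj (z $ 1)) ^ i * (z $ 2 * cnj (z $ 2)) ^ (L - i))
      = fact (L + A) * fact (L + B) * ?f (int i)" if i: "i \<le> L" for i
  proof -
    have 1: "of_nat ((L + A) choose (L - i)) = (fact (L + A) / (fact (L - i) * fact (A + i)) :: complex)"
      using i by (subst binomial_fact) (auto simp: field_simps add.commute)
    have 2: "of_nat ((L + B) choose i) = (fact (L + B) / (fact i * fact (L + B - i)) :: complex)"
      using i by (subst binomial_fact) auto
    have 3: "int L - int i = int (L - i)" "int L + int B - int i = int (L + B - i)"
      "int A + int i = int (A + i)"
      using i by auto
    have 4: "- z $ 1 * cnj (z $ 1) = -1 * (u * u')" "z $ 2 * cnj (z $ 2) = v * v'"
      using u v by simp_all
    have 5: "v ^ (L + B - i) = v ^ B * v ^ (L - i)"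
      using i by (simp flip: power_add add: add.commute)
    show ?thesis
      unfolding 1 2 4 eq 3
      by (simp add: divpow_def 5 power_add power_mult_distrib nat_int_add power_minus[of "u * u'" i] mult_ac)
  qed
  have "jacobi_Q l \<alpha> \<beta> z = (\<Sum>s\<le>L. of_nat ((L + A) choose s) * of_nat ((L + B) choose (L - s))
        * (- z $ 1 * cnj (z $ 1)) ^ (L - s) * (z $ 2 * cnj (z $ 2)) ^ s)"
    by (simp add: jacobi_Q_def eq atLeast0AtMost flip: of_nat_add)
  also have "\<dots> = (\<Sum>i\<le>L. of_nat ((L + A) choose (L - i)) * of_nat ((L + B) choose i)
        * (- z $ 1 * cnj (z $ 1)) ^ i * (z $ 2 * cnj (z $ 2)) ^ (L - i))"
    by (rule sum.reindex_bij_witness[of _ "\<lambda>i. L - i" "\<lambda>i. L - i"]) auto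
  finally have Q: "jacobi_Q l \<alpha> \<beta> z = \<dots>" .
  have "u ^ A * v ^ B * jacobi_Q l \<alpha> \<beta> z = fact (L + A) * fact (L + B) * (\<Sum>i\<le>L. ?f (int i))"
    unfolding Q sum_distrib_left by (rule sum.cong[OF refl]) (rule summand, simp)
  also have "(\<Sum>i\<le>L. ?f (int i)) = (\<Sum>i\<in>{0..l}. ?f i)"
    by (rule sum.reindex_bij_witness[of _ nat int]) (auto simp: eq)
  finally show ?thesis by (simp add: eq flip: of_nat_add)
qed

lemma of_int_mult_fact: "0 < n \<Longrightarrow> of_int n * fact (nat (n - 1)) = (fact (nat n) :: complex)"
  by (simp add: fact_reduce nat_diff_distrib)

text \<open>
  The coefficients \<open>b - d\<close>, \<open>a + d + 1\<close>, \<open>b + c + 1\<close> and \<open>a - c\<close> in the families with a tilde repair a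
  factorial that is one step too small; these two rules move such a coefficient into the first or
  the second factorial.
\<close>

lemma mult_coeff_left:
  fixes m x y q f g h f' :: complex
  assumes "x * y * q = f * g * h" "m * f = f'"
  shows "m * x * y * q = f' * g * h"
  using assms by (metis mult.assoc)

lemma mult_coeff_right:
  fixes m x y q f g h g' :: complex
  assumes "x * y * q = f * g * h" "m * g = g'"
  shows "m * x * y * q = f * g' * h"
  using assms by (metis mult.assoc mult.left_commute)

text \<open>
  In the next four lemmas the prefactor is carried by the variables in the name.  Their exponents
  are \<open>\<bar>c\<bar>\<close> and \<open>\<bar>b - a + c\<bar>\<close>, so the four cases are the four sign patterns of the charge \<open>c\<close> and of
  \<open>b - a + c\<close>.  For negative charge \<open>c = - d\<close> the exponent of \<open>z\<^sub>1\<close>, not that of its conjugate, is the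
  summation index, and the signs \<open>(-1)\<^sup>k\<close> and \<open>(-1)\<^sup>m\<close> differ by \<open>(-1)\<^sup>d\<close>.
\<close>

lemma jacobi_Q_z1_z2bar:
  assumes "0 \<le> c" "a - b \<le> c"
  shows "z $ 1 ^ nat c * cnj (z $ 2) ^ nat (b - a + c) * jacobi_Q (a - c) c (b - a + c) z
    = fact (nat a) * fact (nat b) * charge_poly a b c z"
proof -
  have "charge_poly a b c z = (\<Sum>i\<in>{0..a - c}. (-1) powi i * (divpow (z $ 1) (c + i) *
      divpow (cnj (z $ 1)) i * divpow (cnj (z $ 2)) (b - i) * divpow (z $ 2) (a - c - i)))"
    unfolding charge_poly_def monomial_def using assms
    by (intro sum.reindex_bij_witness[of _ "\<lambda>i. c + i" "\<lambda>k. k - c"]) (auto simp: algebra_simps)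
  with assms show ?thesis by (subst jacobi_Q_divpow) auto
qed

lemma jacobi_Q_z1_z2:
  assumes "0 \<le> c" "c \<le> a - b"
  shows "z $ 1 ^ nat c * z $ 2 ^ nat (a - c - b) * jacobi_Q b c (a - c - b) z
    = fact (nat (b + c)) * fact (nat (a - c)) * charge_poly a b c z"
proof -
  have "charge_poly a b c z = (\<Sum>i\<in>{0..b}. (-1) powi i * (divpow (z $ 1) (c + i) *
      divpow (cnj (z $ 1)) i * divpow (z $ 2) (a - c - i) * divpow (cnj (z $ 2)) (b - i)))"
    unfolding charge_poly_def monomial_def using assms
    by (intro sum.reindex_bij_witness[of _ "\<lambda>i. c + i" "\<lambda>k. k - c"]) (auto simp: algebra_simps)
  with assms show ?thesis by (subst jacobi_Q_divpow) auto
qed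

lemma jacobi_Q_z1bar_z2:
  assumes "0 \<le> d" "b - a \<le> d"
  shows "cnj (z $ 1) ^ nat d * z $ 2 ^ nat (a - b + d) * jacobi_Q (b - d) d (a - b + d) z
    = (-1) powi d * (fact (nat a) * fact (nat b) * charge_poly a b (- d) z)"
proof -
  have "(-1) powi d * charge_poly a b (- d) z = (\<Sum>k\<in>{0..b - d}. (-1) powi k * (divpow (cnj (z $ 1)) (d + k) *
      divpow (z $ 1) k * divpow (z $ 2) (a - k) * divpow (cnj (z $ 2)) (b - d - k)))"
    unfolding charge_poly_def monomial_def sum_distrib_left using assms
    by (intro sum.cong) (auto simp: algebra_simps power_int_add power_int_minus_left)
  with assms show ?thesis by (subst jacobi_Q_divpow) auto
qed

lemma jacobi_Q_z1bar_z2bar: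
  assumes "0 \<le> d" "d \<le> b - a"
  shows "cnj (z $ 1) ^ nat d * cnj (z $ 2) ^ nat (b - d - a) * jacobi_Q a d (b - d - a) z
    = (-1) powi d * (fact (nat (a + d)) * fact (nat (b - d)) * charge_poly a b (- d) z)"
proof -
  have "(-1) powi d * charge_poly a b (- d) z = (\<Sum>k\<in>{0..a}. (-1) powi k * (divpow (cnj (z $ 1)) (d + k) *
      divpow (z $ 1) k * divpow (cnj (z $ 2)) (b - d - k) * divpow (z $ 2) (a - k)))"
    unfolding charge_poly_def monomial_def sum_distrib_left using assms
    by (intro sum.cong) (auto simp: algebra_simps power_int_add power_int_minus_left)
  with assms show ?thesis by (subst jacobi_Q_divpow) auto
qed

section \<open>The four families as members of one family\<close>

text \<open>
  Both components have the same factor \<open>a! b!\<close>, because for \<open>p\<close> and \<open>q\<close> the upper entries of the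
  binomial coefficients are \<open>a\<close> and \<open>b\<close> at charge \<open>c\<close> and at charge \<open>c + 1\<close> alike.
\<close>

lemma p_poly_eq_monogenic:
  assumes "0 \<le> c" "a - b \<le> c" "c \<le> a"
  shows "p_poly a b c = monogenic 1 a b c"
proof
  fix z
  have "z $ 1 ^ nat c * cnj (z $ 2) ^ nat (b - a + c) * jacobi_Q (a - c) c (b - a + c) z
      = fact (nat a) * fact (nat b) * charge_poly a b c z"
    "z $ 1 ^ nat (c + 1) * cnj (z $ 2) ^ nat (b - a + c + 1)
        * jacobi_Q (a - c - 1) (c + 1) (b - a + c + 1) z
      = fact (nat a) * fact (nat b) * charge_poly a b (c + 1) z"
    using jacobi_Q_z1_z2bar[of c a b z] jacobi_Q_z1_z2bar[of "c + 1" a b z] assms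
    by (simp_all add: algebra_simps)
  with assms show "p_poly a b c z = monogenic 1 a b c z"
    by (simp add: p_poly_def monogenic_def vec_eq_iff field_simps)
qed

lemma q_poly_eq_monogenic:
  assumes "0 \<le> d" "b - a \<le> d" "d \<le> b"
  shows "q_poly a b d = monogenic (- ((-1) powi d)) a b (- d - 1)"
proof
  fix z
  have neg: "- 1 - d = - d - 1"
    by simp
  have "cnj (z $ 1) ^ nat (d + 1) * z $ 2 ^ nat (a - b + d + 1)
        * jacobi_Q (b - d - 1) (d + 1) (a - b + d + 1) z
      = - ((-1) powi d) * (fact (nat a) * fact (nat b) * charge_poly a b (- d - 1) z)"
    "cnj (z $ 1) ^ nat d * z $ 2 ^ nat (a - b + d) * jacobi_Q (b - d) d (a - b + d) z
      = (-1) powi d * (fact (nat a) * fact (nat b) * charge_poly a b (- d) z)"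
    using jacobi_Q_z1bar_z2[of "d + 1" b a z] jacobi_Q_z1bar_z2[of d b a z] assms
    by (simp_all add: algebra_simps power_int_add neg)
  with assms show "q_poly a b d z = monogenic (- ((-1) powi d)) a b (- d - 1) z"
    by (simp add: q_poly_def monogenic_def vec_eq_iff field_simps)
qed

text \<open>
  For the families with a tilde the upper entries change with the charge, so the two components
  come with different factorials; the integer coefficients make them equal.  Differentiation can
  lower \<open>b\<close> (for \<open>p~\<close>) or \<open>a\<close> (for \<open>q~\<close>) to \<open>-1\<close> without leaving the range of the last index;
  then both sides are zero.
\<close>

lemma pt_poly_eq_monogenic:
  assumes "0 \<le> c" "c \<le> a - b - 1"
  shows "pt_poly a b c = monogenic 1 a b c"
proof (cases "b < 0")
  case True
  then show ?thesis by (simp add: pt_poly_def monogenic_eq_0 fun_eq_iff)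
next
  case False
  show ?thesis
  proof
    fix z
    have "of_int (b + c + 1) * z $ 1 ^ nat c * z $ 2 ^ nat (a - c - b) * jacobi_Q b c (a - c - b) z
        = fact (nat (b + c + 1)) * fact (nat (a - c)) * charge_poly a b c z"
      using jacobi_Q_z1_z2[of c a b z] of_int_mult_fact[of "b + c + 1"] assms False
      by (intro mult_coeff_left) auto
    moreover have "of_int (a - c) * z $ 1 ^ nat (c + 1) * z $ 2 ^ nat (a - c - b - 1)
          * jacobi_Q b (c + 1) (a - c - b - 1) z
        = fact (nat (b + c + 1)) * fact (nat (a - c)) * charge_poly a b (c + 1) z"
      using jacobi_Q_z1_z2[of "c + 1" a b z] of_int_mult_fact[of "a - c"] assms False
      by (intro mult_coeff_right) (auto simp: algebra_simps)
    ultimately show "pt_poly a b c z = monogenic 1 a b c z"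
      using assms False
      by (simp only: pt_poly_def monogenic_def) (simp add: vec_eq_iff field_simps del: of_int_add of_int_diff)
  qed
qed

lemma qt_poly_eq_monogenic:
  assumes "0 \<le> d" "d \<le> b - a - 1"
  shows "qt_poly a b d = monogenic (- ((-1) powi d)) a b (- d - 1)"
proof (cases "a < 0")
  case True
  then show ?thesis by (simp add: qt_poly_def monogenic_eq_0 fun_eq_iff)
next
  case False
  show ?thesis
  proof
    fix z
    have neg: "- 1 - d = - d - 1"
      by simp
    have "of_int (b - d) * cnj (z $ 1) ^ nat (d + 1) * cnj (z $ 2) ^ nat (b - d - a - 1)
          * jacobi_Q a (d + 1) (b - d - a - 1) z
        = fact (nat (b - d)) * fact (nat (a + d + 1)) * (- ((-1) powi d) * charge_poly a b (- d - 1) z)"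
      using jacobi_Q_z1bar_z2bar[of "d + 1" b a z] of_int_mult_fact[of "b - d"] assms False
      by (intro mult_coeff_left[where f = "fact (nat (b - d - 1))"])
        (auto simp: algebra_simps power_int_add neg)
    moreover have "of_int (a + d + 1) * cnj (z $ 1) ^ nat d * cnj (z $ 2) ^ nat (b - d - a)
          * jacobi_Q a d (b - d - a) z
        = fact (nat (b - d)) * fact (nat (a + d + 1)) * ((-1) powi d * charge_poly a b (- d) z)"
      using jacobi_Q_z1bar_z2bar[of d b a z] of_int_mult_fact[of "a + d + 1"] assms False
      by (intro mult_coeff_right[where g = "fact (nat (a + d))"]) (auto simp: algebra_simps)
    ultimately show "qt_poly a b d z = monogenic (- ((-1) powi d)) a b (- d - 1) z"
      using assms False
      by (simp only: qt_poly_def monogenic_def) (simp add: vec_eq_iff field_simps del: of_int_add of_int_diff)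
  qed
qed

theorem proposition2:
  fixes a b :: int
  assumes "0 \<le> a" and "0 \<le> b"
  shows
   "
    (a < b \<longrightarrow>
      (\<forall>c\<in>{0..a - 1}. dz 2 (p_poly a b c) = p_poly (a - 1) b c) \<and>
      dz 2 (p_poly a b a) = (\<lambda>z. 0) \<and>
      (\<forall>d\<in>{0..b - a - 1}. dz 2 (qt_poly a b d) = qt_poly (a - 1) b d) \<and>
      dz 2 (q_poly a b (b - a)) = qt_poly (a - 1) b (b - a) \<and>
      (\<forall>d\<in>{b - a + 1..b}. dz 2 (q_poly a b d) = q_poly (a - 1) b d) \<and>
      (\<forall>c\<in>{0..a}. dzbar 2 (p_poly a b c) = p_poly a (b - 1) c) \<and>
      (\<forall>d\<in>{0..b - a - 2}. dzbar 2 (qt_poly a b d) = qt_poly a (b - 1) d) \<and>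
      dzbar 2 (qt_poly a b (b - a - 1)) = q_poly a (b - 1) (b - a - 1) \<and>
      (\<forall>d\<in>{b - a..b - 1}. dzbar 2 (q_poly a b d) = q_poly a (b - 1) d) \<and>
      dzbar 2 (q_poly a b b) = (\<lambda>z. 0)) \<and>
    (a > b \<longrightarrow>
      (\<forall>c\<in>{0..a - b - 2}. dz 2 (pt_poly a b c) = pt_poly (a - 1) b c) \<and>
      dz 2 (pt_poly a b (a - b - 1)) = p_poly (a - 1) b (a - b - 1) \<and>
      (\<forall>c\<in>{a - b..a - 1}. dz 2 (p_poly a b c) = p_poly (a - 1) b c) \<and>
      dz 2 (p_poly a b a) = (\<lambda>z. 0) \<and>
      (\<forall>d\<in>{0..b}. dz 2 (q_poly a b d) = q_poly (a - 1) b d) \<and>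
      (\<forall>c\<in>{0..a - b - 1}. dzbar 2 (pt_poly a b c) = pt_poly a (b - 1) c) \<and>
      dzbar 2 (p_poly a b (a - b)) = pt_poly a (b - 1) (a - b) \<and>
      (\<forall>c\<in>{a - b + 1..a}. dzbar 2 (p_poly a b c) = p_poly a (b - 1) c) \<and>
      (\<forall>d\<in>{0..b - 1}. dzbar 2 (q_poly a b d) = q_poly a (b - 1) d) \<and>
      dzbar 2 (q_poly a b b) = (\<lambda>z. 0)) \<and>
    (a = b \<longrightarrow>
      (\<forall>c\<in>{0..a - 1}. dz 2 (p_poly a a c) = p_poly (a - 1) a c) \<and>
      dz 2 (p_poly a a a) = (\<lambda>z. 0) \<and>
      dz 2 (q_poly a a 0) = qt_poly (a - 1) a 0 \<and>
      (\<forall>d\<in>{1..a}. dz 2 (q_poly a a d) = q_poly (a - 1) a d) \<and>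
      dzbar 2 (p_poly a a 0) = pt_poly a (a - 1) 0 \<and>
      (\<forall>c\<in>{1..a}. dzbar 2 (p_poly a a c) = p_poly a (a - 1) c) \<and>
      (\<forall>d\<in>{0..a - 1}. dzbar 2 (q_poly a a d) = q_poly a (a - 1) d) \<and>
      dzbar 2 (q_poly a a a) = (\<lambda>z. 0)) \<and>
    (a < b \<longrightarrow>
      dz 1 (p_poly a b 0) = - qt_poly (a - 1) b 0 \<and>
      (\<forall>c\<in>{1..a}. dz 1 (p_poly a b c) = p_poly (a - 1) b (c - 1)) \<and>
      (\<forall>d\<in>{0..b - a - 1}. dz 1 (qt_poly a b d) = - qt_poly (a - 1) b (d + 1)) \<and>
      (\<forall>d\<in>{b - a..b - 1}. dz 1 (q_poly a b d) = - q_poly (a - 1) b (d + 1)) \<and>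
      dz 1 (q_poly a b b) = (\<lambda>z. 0) \<and>
      (\<forall>c\<in>{0..a - 1}. dzbar 1 (p_poly a b c) = - p_poly a (b - 1) (c + 1)) \<and>
      dzbar 1 (p_poly a b a) = (\<lambda>z. 0) \<and>
      dzbar 1 (qt_poly a b 0) = p_poly a (b - 1) 0 \<and>
      (\<forall>d\<in>{1..b - a - 1}. dzbar 1 (qt_poly a b d) = qt_poly a (b - 1) (d - 1)) \<and>
      (\<forall>d\<in>{b - a..b}. dzbar 1 (q_poly a b d) = q_poly a (b - 1) (d - 1))) \<and>
    (a > b \<longrightarrow>
      dz 1 (pt_poly a b 0) = - q_poly (a - 1) b 0 \<and>
      (\<forall>c\<in>{1..a - b - 1}. dz 1 (pt_poly a b c) = pt_poly (a - 1) b (c - 1)) \<and>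
      (\<forall>c\<in>{a - b..a}. dz 1 (p_poly a b c) = p_poly (a - 1) b (c - 1)) \<and>
      (\<forall>d\<in>{0..b - 1}. dz 1 (q_poly a b d) = - q_poly (a - 1) b (d + 1)) \<and>
      dz 1 (q_poly a b b) = (\<lambda>z. 0) \<and>
      (\<forall>c\<in>{0..a - b - 1}. dzbar 1 (pt_poly a b c) = - pt_poly a (b - 1) (c + 1)) \<and>
      (\<forall>c\<in>{a - b..a - 1}. dzbar 1 (p_poly a b c) = - p_poly a (b - 1) (c + 1)) \<and>
      dzbar 1 (p_poly a b a) = (\<lambda>z. 0) \<and>
      dzbar 1 (q_poly a b 0) = pt_poly a (b - 1) 0 \<and>
      (\<forall>d\<in>{1..b}. dzbar 1 (q_poly a b d) = q_poly a (b - 1) (d - 1))) \<and>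
    (a = b \<longrightarrow>
      dz 1 (p_poly a a 0) = - qt_poly (a - 1) a 0 \<and>
      (\<forall>c\<in>{1..a}. dz 1 (p_poly a a c) = p_poly (a - 1) a (c - 1)) \<and>
      (\<forall>d\<in>{0..a - 1}. dz 1 (q_poly a a d) = - q_poly (a - 1) a (d + 1)) \<and>
      dz 1 (q_poly a a a) = (\<lambda>z. 0) \<and>
      (\<forall>c\<in>{0..a - 1}. dzbar 1 (p_poly a a c) = - p_poly a (a - 1) (c + 1)) \<and>
      dzbar 1 (p_poly a a a) = (\<lambda>z. 0) \<and>
      dzbar 1 (q_poly a a 0) = pt_poly a (a - 1) 0 \<and>
      (\<forall>d\<in>{1..a}. dzbar 1 (q_poly a a d) = q_poly a (a - 1) (d - 1)))"
  using assms
  by (intro conjI impI ballI)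
    (simp_all add: p_poly_eq_monogenic q_poly_eq_monogenic pt_poly_eq_monogenic qt_poly_eq_monogenic
      monogenic_derivs uminus_monogenic power_int_add power_int_diff monogenic_eq_0)

end
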